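(* Let $G=(V,E)$ be a simple graph with $V=\{1,2,\dots,n\}$, let $F$ be a field of characteristic $0$ or $F=\mathbb{Z}_p$ with $p$ prime, and let $(L,C)$ be an $F$-correspondence assignment on $G$. Let $G^g$ be the multigraph formed by replacing each edge $e\in E(G)$ with $\omega^g(e)$ parallel edges $e_1,\dots,e_{\omega^g(e)}$, and let $(L,C^g)$ be the good $F$-correspondence assignment on $G^g$ given by fixed good partial matchings $C^g_{e_1},\dots,C^g_{e_{\omega^g(e)}}$ with $C_e=\bigcup_{i=1}^{\omega^g(e)}C^g_{e_i}$ for each $e\in E(G)$. If there exists an orientation $D$ of $G^g$ such that $EE(D)-EO(D)\not\equiv 0_F$ and $|L(v)|\ge d^+_D(v)+1$ for each $v\in V(G)$, then $G$ is $(L,C)$-colorable.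
   Context: Graphs. Multigraphs and digraphs are finite and loopless; parallel edges are allowed and are regarded as distinct; a graph is simple if it has no parallel edges. Write $e=\{v,w\}$ if $v,w$ are the endpoints of the edge $e$, and $\vec e=(v,w)$ if $\vec e$ is a directed edge from $v$ to $w$. An orientation $D$ of a multigraph $G$ is a digraph on vertex set $V(G)$ obtained by choosing one direction for each edge. $d^+_D(v)$ and $d^-_D(v)$ are the out-degree and in-degree of $v$ in $D$. Eulerian subdigraphs. A digraph $H$ is Eulerian if $d^+_H(v)=d^-_H(v)$ for every vertex $v$ (connectedness is not required). A digraph is even (odd) if it has an even (odd) number of edges. $EE(H)$ and $EO(H)$ denote the numbers of even, respectively odd, spanning Eulerian subdigraphs of $H$ (spanning means having vertex set $V(H)$; the subdigraph with no edges counts). Correspondence assignments. A correspondence assignment $(L,C)$ for a multigraph $G$ consists of lists $L=\{L(v)\}_{v\in V(G)}$ and a function $C$ assigning to every edge $e=\{u,v\}$ a partial matching $C_e$ between $\{u\}\times L(u)$ and $\{v\}\times L(v)$. An $(L,C)$-coloring is a function $f$ with $f(v)\in L(v)$ for all $v$ such that for every edge $e=\{u,v\}$ the pair $\{(u,f(u)),(v,f(v))\}$ is not in $C_e$; $G$ is $(L,C)$-colorable if one exists. For a field $F$, $(L,C)$ is an $F$-correspondence assignment if $L(v)\subseteq F$ for all $v$. Good. A partial matching $M$ between $\{v\}\times L(v)$ and $\{w\}\times L(w)$ is good if there exists $a\in F$ such that $c_1-c_2=a$ for all $\{(v,c_1),(w,c_2)\}\in M$ (this does not depend on the order of $v,w$).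 An $F$-correspondence assignment is good if the matching of every edge is good. For $e=\{i,j\}\in E(G)$ with $i<j$, $$\omega^g(e)=\left|\{a\in F:\text{ there exists }\{(i,c_1),(j,c_2)\}\in C_e\text{ such that }a=c_1-c_2\}\right|,$$ which equals the least $k$ such that $C_e$ can be written as a union of $k$ good matchings. (As all multigraphs are finite, the numbers $\omega^g(e)$ are finite.) For $n\in\mathbb{Z}$, $n\equiv 0_F$ means $n=0$ if $F$ has characteristic $0$, and $n\equiv 0\pmod p$ if $F=\mathbb{Z}_p$. *)

theory Defs
  imports
    "HOL-Library.Cardinality"
    "HOL-Number_Theory.Cong"
    "Graph_Theory.Digraph_Component"
begin

(* Edges are named objects with a two-element endpoint set, so that parallel edges are distinct.
   Directed graphs and their degrees are those of Graph_Theory. *)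

record ('v, 'e) multigraph =
  mverts :: "'v set"
  medges :: "'e set"
  ends :: "'e \<Rightarrow> 'v set"

definition is_multigraph :: "('v, 'e) multigraph \<Rightarrow> bool" where
  "is_multigraph G \<longleftrightarrow> finite (mverts G) \<and> finite (medges G) \<and>
     (\<forall>e\<in>medges G. ends G e \<subseteq> mverts G \<and> card (ends G e) = 2)"

definition is_simple_graph :: "('v, 'e) multigraph \<Rightarrow> bool" where
  "is_simple_graph G \<longleftrightarrow> is_multigraph G \<and> inj_on (ends G) (medges G)"

definition orientation :: "('v, 'e) multigraph \<Rightarrow> ('v, 'e) pre_digraph \<Rightarrow> bool" where
  "orientation G D \<longleftrightarrow> verts D = mverts G \<and> arcs D = medges G \<and>
     (\<forall>e\<in>medges G. ends G e = {tail D e, head D e})"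

definition eulerian :: "('v, 'e) pre_digraph \<Rightarrow> bool" where
  "eulerian H \<longleftrightarrow> (\<forall>v\<in>verts H. out_degree H v = in_degree H v)"

(* A subgraph has the same total tail and head functions as D, so distinct spanning subgraphs
   have distinct arc sets and each one is counted once. *)

definition EE :: "('v, 'e) pre_digraph \<Rightarrow> nat" where
  "EE D = card {H. spanning H D \<and> eulerian H \<and> even (card (arcs H))}"

definition EO :: "('v, 'e) pre_digraph \<Rightarrow> nat" where
  "EO D = card {H. spanning H D \<and> eulerian H \<and> odd (card (arcs H))}"

(* A matching is a set of pairwise disjoint edges, each being the set of its two endpoints. *)

definition partial_matching :: "'x set \<Rightarrow> 'x set \<Rightarrow> 'x set set \<Rightarrow> bool" where
  "partial_matching A B M \<longleftrightarrow>
     (\<forall>m\<in>M. \<exists>x\<in>A. \<exists>y\<in>B. m = {x, y}) \<and> pairwise disjnt M"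

definition correspondence_assignment ::
  "('v, 'e) multigraph \<Rightarrow> ('v \<Rightarrow> 'a set) \<Rightarrow> ('e \<Rightarrow> ('v \<times> 'a) set set) \<Rightarrow> bool" where
  "correspondence_assignment G L C \<longleftrightarrow>
     (\<forall>e\<in>medges G. \<forall>u v. ends G e = {u, v} \<longrightarrow>
        partial_matching ({u} \<times> L u) ({v} \<times> L v) (C e))"

definition LC_coloring ::
  "('v, 'e) multigraph \<Rightarrow> ('v \<Rightarrow> 'a set) \<Rightarrow> ('e \<Rightarrow> ('v \<times> 'a) set set) \<Rightarrow> ('v \<Rightarrow> 'a) \<Rightarrow> bool" where
  "LC_coloring G L C f \<longleftrightarrow> (\<forall>v\<in>mverts G. f v \<in> L v) \<and>
     (\<forall>e\<in>medges G. \<forall>u v. ends G e = {u, v} \<longrightarrow> {(u, f u), (v, f v)} \<notin> C e)"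

definition LC_colorable ::
  "('v, 'e) multigraph \<Rightarrow> ('v \<Rightarrow> 'a set) \<Rightarrow> ('e \<Rightarrow> ('v \<times> 'a) set set) \<Rightarrow> bool" where
  "LC_colorable G L C \<longleftrightarrow> (\<exists>f. LC_coloring G L C f)"

(* The field F is the type 'a itself, so every correspondence assignment with lists of type
   'a set is an F-correspondence assignment. *)

definition good_matching :: "'v \<Rightarrow> 'v \<Rightarrow> ('v \<times> 'a::field) set set \<Rightarrow> bool" where
  "good_matching v w M \<longleftrightarrow> (\<exists>a. \<forall>c1 c2. {(v, c1), (w, c2)} \<in> M \<longrightarrow> c1 - c2 = a)"

definition good_assignment ::
  "('v, 'e) multigraph \<Rightarrow> ('e \<Rightarrow> ('v \<times> 'a::field) set set) \<Rightarrow> bool" where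
  "good_assignment G C \<longleftrightarrow>
     (\<forall>e\<in>medges G. \<forall>u v. ends G e = {u, v} \<longrightarrow> good_matching u v (C e))"

(* card yields 0 on infinite sets; no separate finiteness condition is needed where C e is the
   union of omega_g G C e matchings, since value 0 would then mean C e = {}, so the set of
   differences would be empty, not infinite. *)

definition omega_g ::
  "('v::linorder, 'e) multigraph \<Rightarrow> ('e \<Rightarrow> ('v \<times> 'a::field) set set) \<Rightarrow> 'e \<Rightarrow> nat" where
  "omega_g G C e =
     card {a. \<exists>i j c1 c2. ends G e = {i, j} \<and> i < j \<and> {(i, c1), (j, c2)} \<in> C e \<and> a = c1 - c2}"

(* The parallel copies e_1, ..., e_k of e are the pairs (e, 1), ..., (e, k). *)

definition expand_g ::
  "('v::linorder, 'e) multigraph \<Rightarrow> ('e \<Rightarrow> ('v \<times> 'a::field) set set) \<Rightarrow>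
   ('v, 'e \<times> nat) multigraph" where
  "expand_g G C =
     \<lparr> mverts = mverts G, medges = (SIGMA e:medges G. {1..omega_g G C e}),
       ends = (\<lambda>(e, i). ends G e) \<rparr>"

(* Characteristic 0 or, up to isomorphism, Z_p: the fields with a prime number p of elements. *)

definition char0_or_prime_field :: "'a::field itself \<Rightarrow> bool" where
  "char0_or_prime_field _ \<longleftrightarrow> CHAR('a) = 0 \<or> (\<exists>p. prime p \<and> CHAR('a) = p \<and> CARD('a) = p)"

definition zero_F :: "'a::field itself \<Rightarrow> int \<Rightarrow> bool" where
  "zero_F _ n \<longleftrightarrow> (if CHAR('a) = 0 then n = 0 else [n = 0] (mod int CHAR('a)))"

end

(*
  For a list S of d + 1 field elements, the functional p |-> sum over c in S of w c * p(c), with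
  the Lagrange weights w c, reads off the coefficient of x^d of any polynomial p of degree at most
  d. The product of these functionals over the vertices, applied to the product over the arcs of
  D of (x_tail - x_head - a_e), where a_e is the constant of the good matching of the arc e, reads
  off the coefficient of the monomial with exponents the out-degrees of D. The constants a_e do
  not contribute to this top-degree coefficient, and choosing x_head on the arc set A
  and x_tail elsewhere yields this monomial exactly if A is Eulerian, so the coefficient is
  EE D - EO D. Being nonzero in F, it forces some point of the grid to be a nonzero of the
  product, which is a colouring.
*)
theory Submission
  imports Defs "HOL-Computational_Algebra.Polynomial" "HOL-Library.FuncSet"
begin

section \<open>Lagrange weights for a single list\<close>

text \<open>Lagrange interpolation on the \<open>d + 1\<close> points of \<open>S\<close> reproduces
  \<open>x ^ k\<close> for \<open>k \<le> d\<close>. Comparing the coefficients of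
  \<open>x ^ d\<close> on both sides gives the identity.\<close>

lemma top_coefficient_weights:
  fixes S :: "'a::field set"
  assumes "card S = Suc d"
  shows "\<exists>w. \<forall>k\<le>d. (\<Sum>c\<in>S. w c * c ^ k) = of_bool (k = d)"
proof -
  have fin: "finite S" using assms by (metis card.infinite nat.distinct(1))
  \<comment> \<open>The Lagrange basis polynomial at \<open>c\<close> before normalization: it is
    monic of degree \<open>d\<close> and vanishes on the rest of \<open>S\<close>. Being monic, it
    contributes exactly the weight \<open>w c\<close> to the top coefficient.\<close>
  define q where "q c = (\<Prod>b\<in>S - {c}. [:- b, 1:])" for c
  define w where "w c = inverse (poly (q c) c)" for c
  have q_self: "poly (q c) c \<noteq> 0" for c
    using fin by (auto simp: q_def poly_prod)
  have q_other: "poly (q c) b = 0" if "b \<in> S" "b \<noteq> c" for b c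
    using that fin by (auto simp: q_def poly_prod prod_zero_iff)
  have deg_q: "degree (q c) = d" if "c \<in> S" for c
    using that assms fin unfolding q_def
    by (subst degree_prod_eq_sum_degree) (auto simp: card_Diff_singleton)
  have lead_q: "coeff (q c) d = 1" if "c \<in> S" for c
    using lead_coeff_prod[of "\<lambda>b. [:- b, 1:]" "S - {c}"] deg_q[OF that]
    by (simp add: q_def)
  have "(\<Sum>c\<in>S. w c * c ^ k) = of_bool (k = d)" if "k \<le> d" for k
  proof -
    define p where "p = (\<Sum>c\<in>S. smult (w c * c ^ k) (q c))"
    have "p = monom 1 k"
    proof (rule poly_eqI_degree)
      fix b assume b: "b \<in> S"
      have "poly p b = (\<Sum>c\<in>S. if c = b then b ^ k else 0)"
        unfolding p_def poly_sum using b q_self q_other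
        by (intro sum.cong) (auto simp: w_def)
      then show "poly p b = poly (monom 1 k) b"
        using b fin by (simp add: poly_monom)
    next
      have "degree p \<le> d"
        unfolding p_def using deg_q
        by (intro degree_sum_le fin) (metis degree_smult_le)
      then show "degree p < card S" using assms by simp
      show "degree (monom (1::'a) k) < card S"
        using assms that by (simp add: degree_monom_eq)
    qed
    then have "coeff p d = of_bool (k = d)" by simp
    then show ?thesis
      unfolding p_def coeff_sum using lead_q by simp
  qed
  then show ?thesis by blast
qed

section \<open>Weighted sums over a grid\<close>

context
  fixes V :: "'v set" and S :: "'v \<Rightarrow> 'a::field set" and w :: "'v \<Rightarrow> 'a \<Rightarrow> 'a" and d :: "'v \<Rightarrow> nat"
  assumes fin_V: "finite V"
    and fin_S: "\<And>v. v \<in> V \<Longrightarrow> finite (S v)"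
    and weights: "\<And>v k. v \<in> V \<Longrightarrow> k \<le> d v \<Longrightarrow> (\<Sum>c\<in>S v. w v c * c ^ k) = of_bool (k = d v)"
begin

text \<open>The sum factors over the vertices, the exponent at \<open>v\<close> being the number of
  \<open>e\<close> in \<open>B\<close> with \<open>g e = v\<close>. These exponents add up to
  \<open>card B \<le> sum d V\<close>, so either one of them falls short of \<open>d\<close> and its
  factor is 0, or all agree with \<open>d\<close> and every factor is 1.\<close>

lemma grid_sum_monomial:
  assumes "finite B" "\<And>e. e \<in> B \<Longrightarrow> g e \<in> V" and le: "card B \<le> sum d V"
  shows "(\<Sum>f\<in>PiE V S. (\<Prod>v\<in>V. w v (f v)) * (\<Prod>e\<in>B. f (g e))) =
    of_bool (\<forall>v\<in>V. card {e\<in>B. g e = v} = d v)"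
proof -
  define k where "k v = card {e\<in>B. g e = v}" for v
  have sum_k: "sum k V = card B"
    unfolding k_def using sum.group[OF assms(1) fin_V, of g "\<lambda>_. 1::nat"] assms(2) by auto
  have "(\<Sum>f\<in>PiE V S. (\<Prod>v\<in>V. w v (f v)) * (\<Prod>e\<in>B. f (g e))) =
      (\<Sum>f\<in>PiE V S. \<Prod>v\<in>V. w v (f v) * f v ^ k v)"
  proof (rule sum.cong[OF refl])
    fix f :: "'v \<Rightarrow> 'a"
    have "(\<Prod>e\<in>B. f (g e)) = (\<Prod>v\<in>V. \<Prod>e\<in>{e\<in>B. g e = v}. f (g e))"
      using assms(1,2) fin_V by (intro prod.group[symmetric]) auto
    also have "\<dots> = (\<Prod>v\<in>V. f v ^ k v)"
      unfolding k_def by (intro prod.cong refl) simp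
    finally show "(\<Prod>v\<in>V. w v (f v)) * (\<Prod>e\<in>B. f (g e)) = (\<Prod>v\<in>V. w v (f v) * f v ^ k v)"
      by (simp add: prod.distrib)
  qed
  also have "\<dots> = (\<Prod>v\<in>V. \<Sum>c\<in>S v. w v c * c ^ k v)"
    by (intro prod_sum_PiE[symmetric] fin_V fin_S)
  also have "\<dots> = of_bool (\<forall>v\<in>V. k v = d v)"
  proof (cases "\<exists>u\<in>V. k u < d u")
    case True
    then obtain u where u: "u \<in> V" "k u < d u" by blast
    then have "(\<Sum>c\<in>S u. w u c * c ^ k u) = 0" using weights[of u "k u"] by simp
    then have "(\<Prod>v\<in>V. \<Sum>c\<in>S v. w v c * c ^ k v) = 0" using u fin_V by (meson prod_zero)
    then show ?thesis using u by force
  next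
    case False
    \<comment> \<open>No exponent falls short here, so a single excess would push the total degree
      above \<open>sum d V\<close>.\<close>
    have eq: "k v = d v" if "v \<in> V" for v
    proof (rule ccontr)
      assume "k v \<noteq> d v"
      with False that have "d v < k v" by force
      then have "sum d V < sum k V"
        using False that fin_V by (intro sum_strict_mono_ex1) (auto simp: not_less)
      then show False using le sum_k by simp
    qed
    then show ?thesis by (auto simp: weights intro!: prod.neutral)
  qed
  finally show ?thesis unfolding k_def .
qed

text \<open>Expanding the product of differences gives one signed monomial for each set
  \<open>A\<close> of arcs that contribute their head; the other arcs contribute their tail.\<close>

lemma grid_sum_differences:
  assumes "finite B" "\<And>e. e \<in> B \<Longrightarrow> t e \<in> V \<and> h e \<in> V" and "card B \<le> sum d V"
  shows "(\<Sum>f\<in>PiE V S. (\<Prod>v\<in>V. w v (f v)) * (\<Prod>e\<in>B. f (t e) - f (h e))) =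
    (\<Sum>A\<in>Pow B. (-1) ^ card A *
      of_bool (\<forall>v\<in>V. card {e\<in>B. (if e \<in> A then h e else t e) = v} = d v))"
proof -
  let ?g = "\<lambda>A e. if e \<in> A then h e else t e"
  let ?W = "\<lambda>f. \<Prod>v\<in>V. w v (f v)"
  have split: "(\<Prod>e\<in>A. f (h e)) * (\<Prod>e\<in>B - A. f (t e)) = (\<Prod>e\<in>B. f (?g A e))"
    if "A \<subseteq> B" for A and f :: "'v \<Rightarrow> 'a"
  proof -
    have "(\<Prod>e\<in>B. f (?g A e)) = (\<Prod>e\<in>B - A. f (?g A e)) * (\<Prod>e\<in>A. f (?g A e))"
      using that assms(1) by (rule prod.subset_diff)
    then show ?thesis by (simp add: mult.commute)
  qed
  have "?W f * (\<Prod>e\<in>B. f (t e) - f (h e)) =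
      (\<Sum>A\<in>Pow B. (-1) ^ card A * (?W f * (\<Prod>e\<in>B. f (?g A e))))" for f
    unfolding prod_diff_conv_sum[OF assms(1)] sum_distrib_left
  proof (rule sum.cong[OF refl])
    fix A assume "A \<in> Pow B"
    then show "?W f * ((-1) ^ card A * (\<Prod>e\<in>A. f (h e)) * (\<Prod>e\<in>B - A. f (t e))) =
        (-1) ^ card A * (?W f * (\<Prod>e\<in>B. f (?g A e)))"
      using split[of A f] by (simp add: mult_ac)
  qed
  then have "(\<Sum>f\<in>PiE V S. ?W f * (\<Prod>e\<in>B. f (t e) - f (h e))) =
      (\<Sum>A\<in>Pow B. (-1) ^ card A * (\<Sum>f\<in>PiE V S. ?W f * (\<Prod>e\<in>B. f (?g A e))))"
    by (simp add: sum_distrib_left sum.swap[of _ "PiE V S"])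
  also have "\<dots> = (\<Sum>A\<in>Pow B. (-1) ^ card A * of_bool (\<forall>v\<in>V. card {e\<in>B. ?g A e = v} = d v))"
    using assms by (intro sum.cong refl arg_cong2[where f = "(*)"] grid_sum_monomial) auto
  finally show ?thesis .
qed

text \<open>Each arc that contributes its constant \<open>a e\<close> lowers the degree in the
  variables, and the weights annihilate everything below degree \<open>sum d V\<close>. Hence the
  right-hand side is free of \<open>a\<close>.\<close>

lemma grid_sum_shifted_differences:
  assumes fin: "finite E" and "\<And>e. e \<in> E \<Longrightarrow> t e \<in> V \<and> h e \<in> V"
    and d: "\<And>v. v \<in> V \<Longrightarrow> d v = card {e\<in>E. t e = v}"
  shows "(\<Sum>f\<in>PiE V S. (\<Prod>v\<in>V. w v (f v)) * (\<Prod>e\<in>E. f (t e) - f (h e) - a e)) =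
    (\<Sum>A\<in>Pow E. (-1) ^ card A *
      of_bool (\<forall>v\<in>V. card {e\<in>A. t e = v} = card {e\<in>A. h e = v}))"
proof -
  let ?g = "\<lambda>A e. if e \<in> A then h e else t e"
  let ?W = "\<lambda>f. \<Prod>v\<in>V. w v (f v)"
  let ?D = "\<lambda>B. \<Sum>f\<in>PiE V S. ?W f * (\<Prod>e\<in>B. f (t e) - f (h e))"
  have sum_d: "sum d V = card E"
    using sum.group[OF fin fin_V, of t "\<lambda>_. 1::nat"] assms(2) d by auto
  \<comment> \<open>Every monomial in the expansion over a proper subset \<open>B\<close> has total
    degree \<open>card B < sum d V\<close>, so its exponents cannot all equal
    \<open>d\<close>.\<close>
  have subset_vanish: "?D B = 0" if "B \<subset> E" for B
  proof -
    have less: "card B < sum d V" using that fin sum_d by (simp add: psubset_card_mono)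
    have fin_B: "finite B" using that fin finite_subset by blast
    have unattained: "\<not> (\<forall>v\<in>V. card {e\<in>B. ?g A e = v} = d v)" for A
    proof
      assume "\<forall>v\<in>V. card {e\<in>B. ?g A e = v} = d v"
      then have "sum d V = (\<Sum>v\<in>V. card {e\<in>B. ?g A e = v})" by simp
      also have "\<dots> = card B"
      proof -
        have "?g A ` B \<subseteq> V" using assms(2) that by auto
        from sum.group[OF fin_B fin_V this, of "\<lambda>_. 1::nat"] show ?thesis by simp
      qed
      finally show False using less by simp
    qed
    have "?D B = (\<Sum>A\<in>Pow B. (-1) ^ card A * of_bool (\<forall>v\<in>V. card {e\<in>B. ?g A e = v} = d v))"
      using that assms(2) less fin_B by (intro grid_sum_differences) auto
    then show ?thesis using unattained by simp
  qed
  have vanish: "?D B * (\<Prod>e\<in>E - B. - a e) = 0" if "B \<in> Pow E - {E}" for B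
  proof -
    have "B \<subset> E" using that by blast
    then have "?D B = 0" by (rule subset_vanish)
    then show ?thesis by (simp only: mult_zero_left)
  qed
  have "(\<Sum>f\<in>PiE V S. ?W f * (\<Prod>e\<in>E. f (t e) - f (h e) - a e)) =
      (\<Sum>f\<in>PiE V S. \<Sum>B\<in>Pow E. ?W f * (\<Prod>e\<in>B. f (t e) - f (h e)) * (\<Prod>e\<in>E - B. - a e))"
  proof (rule sum.cong[OF refl])
    fix f :: "'v \<Rightarrow> 'a"
    show "?W f * (\<Prod>e\<in>E. f (t e) - f (h e) - a e) =
        (\<Sum>B\<in>Pow E. ?W f * (\<Prod>e\<in>B. f (t e) - f (h e)) * (\<Prod>e\<in>E - B. - a e))"
      using prod_add[OF fin, of "\<lambda>e. f (t e) - f (h e)" "\<lambda>e. - a e"]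
      by (simp add: sum_distrib_left mult.assoc)
  qed
  also have "\<dots> = (\<Sum>B\<in>Pow E. ?D B * (\<Prod>e\<in>E - B. - a e))"
    by (subst sum.swap) (simp add: sum_distrib_right)
  also have "\<dots> = ?D E"
  proof -
    \<comment> \<open>Only \<open>B = E\<close> survives, and there the product of constants is
      empty.\<close>
    have "(\<Sum>B\<in>Pow E - {E}. ?D B * (\<Prod>e\<in>E - B. - a e)) = 0"
      by (rule sum.neutral) (use vanish in blast)
    then show ?thesis using fin by (subst sum.remove[of _ E]) simp_all
  qed
  also have "\<dots> = (\<Sum>A\<in>Pow E. (-1) ^ card A * of_bool (\<forall>v\<in>V. card {e\<in>E. ?g A e = v} = d v))"
    using assms(1,2) sum_d by (intro grid_sum_differences) auto
  also have "\<dots> = (\<Sum>A\<in>Pow E. (-1) ^ card A *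
      of_bool (\<forall>v\<in>V. card {e\<in>A. t e = v} = card {e\<in>A. h e = v}))"
  proof (intro sum.cong refl arg_cong2[where f = "(*)"] arg_cong[where f = of_bool] ball_cong)
    fix A v assume A: "A \<in> Pow E" and v: "v \<in> V"
    then have fin_A: "finite A" using fin finite_subset by blast
    \<comment> \<open>Arcs outside \<open>A\<close> contribute their tail both to the exponent of
      \<open>v\<close> and to its out-degree \<open>d v\<close>. Cancelling them leaves the balance
      of tails and heads within \<open>A\<close>.\<close>
    have "{e\<in>E. ?g A e = v} = {e\<in>A. h e = v} \<union> {e\<in>E - A. t e = v}"
      and "{e\<in>E. t e = v} = {e\<in>A. t e = v} \<union> {e\<in>E - A. t e = v}"
      using A by auto
    then have "card {e\<in>E. ?g A e = v} = card {e\<in>A. h e = v} + card {e\<in>E - A. t e = v}"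
      and "card {e\<in>E. t e = v} = card {e\<in>A. t e = v} + card {e\<in>E - A. t e = v}"
      using fin fin_A by (auto intro!: card_Un_disjoint)
    then show "(card {e\<in>E. ?g A e = v} = d v) = (card {e\<in>A. t e = v} = card {e\<in>A. h e = v})"
      using d[OF v] by auto
  qed
  finally show ?thesis .
qed

end

section \<open>Eulerian subdigraphs as arc sets\<close>

text \<open>A spanning subgraph shares its vertices and its tail and head functions with
  \<open>D\<close>, so \<open>arcs\<close> is a bijection onto the balanced arc sets. The predicate
  \<open>P\<close> serves both parities.\<close>

lemma card_spanning_eulerian:
  fixes D :: "('v, 'e) pre_digraph"
  assumes "wf_digraph D"
  shows "card {H. spanning H D \<and> eulerian H \<and> P (card (arcs H))} =
    card {A\<in>Pow (arcs D). (\<forall>v\<in>verts D. card {e\<in>A. tail D e = v} = card {e\<in>A. head D e = v}) \<and>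
      P (card A)}"
proof (rule bij_betw_same_card[where f = arcs], rule bij_betwI')
  fix H H' :: "('v, 'e) pre_digraph"
  assume "H \<in> {H. spanning H D \<and> eulerian H \<and> P (card (arcs H))}"
    and "H' \<in> {H. spanning H D \<and> eulerian H \<and> P (card (arcs H))}"
  then show "(arcs H = arcs H') = (H = H')"
    by (auto simp: spanning_def subgraph_def compatible_def intro!: pre_digraph.equality)
next
  fix H assume "H \<in> {H. spanning H D \<and> eulerian H \<and> P (card (arcs H))}"
  then show "arcs H \<in> {A\<in>Pow (arcs D).
      (\<forall>v\<in>verts D. card {e\<in>A. tail D e = v} = card {e\<in>A. head D e = v}) \<and> P (card A)}"
    by (auto simp: spanning_def subgraph_def compatible_def eulerian_def
        out_degree_def in_degree_def out_arcs_def in_arcs_def)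
next
  fix A
  assume A: "A \<in> {A\<in>Pow (arcs D).
      (\<forall>v\<in>verts D. card {e\<in>A. tail D e = v} = card {e\<in>A. head D e = v}) \<and> P (card A)}"
  let ?H = "\<lparr>verts = verts D, arcs = A, tail = tail D, head = head D\<rparr>"
  have "wf_digraph ?H" using A assms by (auto simp: wf_digraph_def)
  then have "?H \<in> {H. spanning H D \<and> eulerian H \<and> P (card (arcs H))}"
    using A assms by (auto simp: spanning_def subgraph_def compatible_def eulerian_def
        out_degree_def in_degree_def out_arcs_def in_arcs_def)
  then show "\<exists>H\<in>{H. spanning H D \<and> eulerian H \<and> P (card (arcs H))}. A = arcs H"
    by (rule bexI[rotated]) simp
qed

text \<open>Brings the difference of the two counts into the form of the signed sum in
  \<open>grid_sum_shifted_differences\<close>.\<close>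

lemma EE_minus_EO:
  fixes D :: "('v, 'e) pre_digraph"
  assumes "wf_digraph D" and fin: "finite (arcs D)"
  shows "int (EE D) - int (EO D) = (\<Sum>A\<in>Pow (arcs D). (-1) ^ card A *
    of_bool (\<forall>v\<in>verts D. card {e\<in>A. tail D e = v} = card {e\<in>A. head D e = v}))"
proof -
  define Q where "Q A \<longleftrightarrow> (\<forall>v\<in>verts D. card {e\<in>A. tail D e = v} = card {e\<in>A. head D e = v})" for A
  have count: "int (card {A\<in>Pow (arcs D). Q A \<and> P (card A)}) =
      (\<Sum>A\<in>Pow (arcs D). of_bool (Q A \<and> P (card A)))" for P
    using fin by (simp add: of_bool_def sum.inter_filter[symmetric])
  have "int (EE D) - int (EO D) = (\<Sum>A\<in>Pow (arcs D). (-1) ^ card A * of_bool (Q A))"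
    unfolding EE_def EO_def card_spanning_eulerian[OF assms(1), of even]
      card_spanning_eulerian[OF assms(1), of odd] Q_def[symmetric]
      count[of even] count[of odd] sum_subtractf[symmetric]
    by (intro sum.cong) auto
  then show ?thesis unfolding Q_def .
qed

section \<open>Nonvanishing points\<close>

lemma zero_F_iff: "zero_F TYPE('a::field) z \<longleftrightarrow> (of_int z :: 'a) = 0"
  by (auto simp: zero_F_def of_int_eq_0_iff_char_dvd cong_0_iff)

text \<open>The special case of Alon's Combinatorial Nullstellensatz needed here.\<close>

lemma exists_nonvanishing_arc_differences:
  fixes D :: "('v, 'e) pre_digraph" and a :: "'e \<Rightarrow> 'a::field" and L :: "'v \<Rightarrow> 'a set"
  assumes "wf_digraph D" "finite (verts D)" "finite (arcs D)"
    and nz: "\<not> zero_F TYPE('a) (int (EE D) - int (EO D))"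
    and L: "\<And>v. v \<in> verts D \<Longrightarrow> infinite (L v) \<or> card (L v) \<ge> out_degree D v + 1"
  obtains f where "\<And>v. v \<in> verts D \<Longrightarrow> f v \<in> L v"
    and "\<And>e. e \<in> arcs D \<Longrightarrow> f (tail D e) - f (head D e) \<noteq> a e"
proof -
  define d where "d = out_degree D"
  \<comment> \<open>The weights need exactly \<open>d v + 1\<close> points, so each list, possibly
    infinite, is cut down to a finite sublist of that size.\<close>
  have "\<exists>S\<subseteq>L v. card S = Suc (d v) \<and> finite S" if "v \<in> verts D" for v
    using L[OF that] unfolding d_def
    by (metis Suc_eq_plus1 infinite_arbitrarily_large obtain_subset_with_card_n)
  then obtain S where S: "\<And>v. v \<in> verts D \<Longrightarrow> S v \<subseteq> L v"
    "\<And>v. v \<in> verts D \<Longrightarrow> card (S v) = Suc (d v)" "\<And>v. v \<in> verts D \<Longrightarrow> finite (S v)"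
    by metis
  then have "\<forall>v\<in>verts D. \<exists>w. \<forall>k\<le>d v. (\<Sum>c\<in>S v. w c * c ^ k) = of_bool (k = d v)"
    by (intro ballI top_coefficient_weights) simp
  then obtain w where w: "\<And>v k. v \<in> verts D \<Longrightarrow> k \<le> d v \<Longrightarrow>
      (\<Sum>c\<in>S v. w v c * c ^ k) = of_bool (k = d v)"
    by metis
  have "(\<Sum>f\<in>PiE (verts D) S. (\<Prod>v\<in>verts D. w v (f v)) *
      (\<Prod>e\<in>arcs D. f (tail D e) - f (head D e) - a e)) =
      (\<Sum>A\<in>Pow (arcs D). (-1) ^ card A *
      of_bool (\<forall>v\<in>verts D. card {e\<in>A. tail D e = v} = card {e\<in>A. head D e = v}))"
    using assms(1-3) S(3) w
    by (intro grid_sum_shifted_differences[where d = d])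
      (auto simp: d_def out_degree_def out_arcs_def wf_digraph_def)
  also have "\<dots> = of_int (int (EE D) - int (EO D))"
    unfolding EE_minus_EO[OF assms(1,3)] by simp
  also have "\<dots> \<noteq> 0" using nz unfolding zero_F_iff .
  \<comment> \<open>A nonzero sum has a nonzero term, and no factor of that term vanishes.\<close>
  finally obtain f where f: "f \<in> PiE (verts D) S"
    "(\<Prod>v\<in>verts D. w v (f v)) * (\<Prod>e\<in>arcs D. f (tail D e) - f (head D e) - a e) \<noteq> 0"
    by (meson sum.not_neutral_contains_not_neutral)
  show thesis
  proof
    show "f v \<in> L v" if "v \<in> verts D" for v using f(1) S(1) that by (auto simp: PiE_iff)
    show "f (tail D e) - f (head D e) \<noteq> a e" if "e \<in> arcs D" for e
      using f(2) assms(3) that by auto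
  qed
qed

section \<open>Correspondence coloring\<close>

theorem corollary31:
  fixes n :: nat
    and G :: "(nat, 'e) multigraph"
    and L :: "nat \<Rightarrow> 'a::field set"
    and C :: "'e \<Rightarrow> (nat \<times> 'a) set set"
    and Cg :: "'e \<times> nat \<Rightarrow> (nat \<times> 'a) set set"
  assumes "char0_or_prime_field TYPE('a)"
    and "is_simple_graph G"
    and "mverts G = {1..n}"
    and "correspondence_assignment G L C"
    and "correspondence_assignment (expand_g G C) L Cg"
    and "good_assignment (expand_g G C) Cg"
    and "\<forall>e\<in>medges G. C e = (\<Union>i\<in>{1..omega_g G C e}. Cg (e, i))"
    and "\<exists>D. orientation (expand_g G C) D \<and>
           \<not> zero_F TYPE('a) (int (EE D) - int (EO D)) \<and>
           (\<forall>v\<in>mverts G. infinite (L v) \<or> card (L v) \<ge> out_degree D v + 1)"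
  shows "LC_colorable G L C"
proof -
  obtain D where D: "orientation (expand_g G C) D"
    and nz: "\<not> zero_F TYPE('a) (int (EE D) - int (EO D))"
    and L: "\<forall>v\<in>mverts G. infinite (L v) \<or> card (L v) \<ge> out_degree D v + 1"
    using assms(8) by blast
  have verts: "verts D = mverts G"
    and arcs: "arcs D = (SIGMA e:medges G. {1..omega_g G C e})"
    and ends: "\<And>x. x \<in> arcs D \<Longrightarrow> ends G (fst x) = {tail D x, head D x}"
    using D by (auto simp: orientation_def expand_g_def)
  have G: "finite (medges G)" "\<And>e. e \<in> medges G \<Longrightarrow> ends G e \<subseteq> mverts G"
    using assms(2) by (auto simp: is_simple_graph_def is_multigraph_def)
  have fin: "finite (arcs D)" unfolding arcs using G(1) by auto
  have "tail D x \<in> verts D \<and> head D x \<in> verts D" if "x \<in> arcs D" for x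
    using ends[OF that] G(2)[of "fst x"] that verts unfolding arcs by auto
  then have wf: "wf_digraph D" by (simp add: wf_digraph_def)
  \<comment> \<open>Reading each good matching from tail to head fixes the sign of its constant to
    suit the difference \<open>f (tail D x) - f (head D x)\<close>.\<close>
  have "good_matching (tail D x) (head D x) (Cg x)" if "x \<in> arcs D" for x
    using assms(6) D that by (auto simp: good_assignment_def orientation_def)
  then have "\<forall>x\<in>arcs D. \<exists>a. \<forall>c1 c2. {(tail D x, c1), (head D x, c2)} \<in> Cg x \<longrightarrow> c1 - c2 = a"
    by (simp add: good_matching_def)
  then obtain a where a: "\<And>x c1 c2. x \<in> arcs D \<Longrightarrow>
      {(tail D x, c1), (head D x, c2)} \<in> Cg x \<Longrightarrow> c1 - c2 = a x"
    by metis
  obtain f where f: "\<And>v. v \<in> verts D \<Longrightarrow> f v \<in> L v"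
    "\<And>x. x \<in> arcs D \<Longrightarrow> f (tail D x) - f (head D x) \<noteq> a x"
    using exists_nonvanishing_arc_differences[OF wf _ fin nz, of L a] L assms(3) verts by auto
  have "{(u, f u), (v, f v)} \<notin> C e" if e: "e \<in> medges G" "ends G e = {u, v}" for e u v
  proof
    assume "{(u, f u), (v, f v)} \<in> C e"
    \<comment> \<open>A conflict on \<open>e\<close> already lies in the matching of one parallel
      copy \<open>(e, i)\<close>, which is an arc of \<open>D\<close>.\<close>
    then obtain i where i: "i \<in> {1..omega_g G C e}" "{(u, f u), (v, f v)} \<in> Cg (e, i)"
      using assms(7) e(1) by auto
    let ?x = "(e, i)"
    have x: "?x \<in> arcs D" using e(1) i(1) by (simp add: arcs)
    then have "{u, v} = {tail D ?x, head D ?x}" using ends[OF x] e(2) by simp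
    \<comment> \<open>The pair is unordered, so it is the tail-head pair of the arc whichever of
      \<open>u\<close> and \<open>v\<close> is the tail.\<close>
    then have "{(u, f u), (v, f v)} = {(tail D ?x, f (tail D ?x)), (head D ?x, f (head D ?x))}"
      by (auto simp: doubleton_eq_iff)
    then show False using a[OF x] f(2)[OF x] i(2) by auto
  qed
  then show ?thesis
    unfolding LC_colorable_def LC_coloring_def using f(1) verts by blast
qed

end
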